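(* Let $\{A_n\}_{n\ge 0}$ be the annihilation-creation process on $\mathbf{Z}$ with parameter $K=2$ started from $A_0=\{0\}$ (defined in the context), and let $O_n$ denote the age of the oldest particle of $A_n$. Let $F(x)=(1-\exp(-x^2))\,\mathbf{1}_{(0,\infty)}(x)$ for $x\in\mathbf{R}$. Then, as $n\to\infty$, $(n-O_n)/\sqrt{n}$ converges in distribution to the probability law with distribution function $F$.
   Context: Annihilation-creation process with parameter $K=2$: a Markov chain $\{A_n\}_{n\ge0}$ of finite nonempty subsets of $\mathbf{Z}$ (sites occupied by particles). Given $A_n$, the set $A_{n+1}$ is constructed (in period $n+1$) by first adding two sites one by one and then deleting one site. In each addition step, a new particle is placed at a site chosen uniformly from the boundary of the current set of occupied sites, where the boundary of $a\subset\mathbf{Z}$ is $\partial a=\{y\in\mathbf{Z}\setminus a:\ \exists x\in a,\ |x-y|=1\}$. In the deletion step, the particle to be removed is at a site chosen uniformly from the current set of occupied sites. For $x\in A_n$, $Y_n(x)$ is the number of deletions which have happened (up to the end of period $n$) since the particle present at $x$ at time $n$ was added; the initial particle at $0$ is regarded as present from time $0$ on. The age of the oldest particle is $O_n=\max\{Y_n(x): x\in A_n\}$. (For example $O_1=1$ and $O_2=2$.) *)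

theory Defs
  imports "HOL-Probability.Probability"
begin

definition boundary :: "int set \<Rightarrow> int set" where
  "boundary a = {y. y \<notin> a \<and> (\<exists>x\<in>a. \<bar>x - y\<bar> = 1)}"

definition creation :: "int set \<Rightarrow> int set pmf" where
  "creation a = map_pmf (\<lambda>y. insert y a) (pmf_of_set (boundary a))"

definition annihilation :: "int set \<Rightarrow> int set pmf" where
  "annihilation a = map_pmf (\<lambda>x. a - {x}) (pmf_of_set a)"

definition period :: "int set \<Rightarrow> int set pmf" where
  "period a = creation a \<bind> (\<lambda>b. creation b \<bind> (\<lambda>c. annihilation c))"

definition configs :: "int set set" where
  "configs = {a. finite a \<and> a \<noteq> {}}"

text \<open>
  The state space is countable, so the Markov property is stated elementwise: whenever the
  event that the chain has followed the path a up to time n has positive probability, the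
  conditional law of the next state is the transition law \<^term>\<open>period (a n)\<close>.
\<close>

definition annihilation_creation_process ::
    "'w measure \<Rightarrow> (nat \<Rightarrow> 'w \<Rightarrow> int set) \<Rightarrow> bool" where
  "annihilation_creation_process M A \<longleftrightarrow>
     prob_space M \<and>
     (\<forall>n. A n \<in> M \<rightarrow>\<^sub>M count_space configs) \<and>
     (AE \<omega> in M. A 0 \<omega> = {0}) \<and>
     (\<forall>n a. \<P>(\<omega> in M. \<forall>i\<le>n. A i \<omega> = a i) > 0 \<longrightarrow>
        \<P>(\<omega> in M. A (Suc n) \<omega> = a (Suc n) \<bar> \<forall>i\<le>n. A i \<omega> = a i) =
          pmf (period (a n)) (a (Suc n)))"

text \<open>
  Within a period both additions precede the deletion and use vacant sites only. Hence a site
  occupied at two successive times carries the same particle at both, and a particle that is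
  present at x at time n was already there when the deletion of period k (\<open>1 \<le> k \<le> n\<close>) took
  place iff x is occupied at all times k, ..., n. So the age, i.e. the number of deletions
  since the particle was added, is a function of the path of the chain.
\<close>

definition age :: "(nat \<Rightarrow> int set) \<Rightarrow> nat \<Rightarrow> int \<Rightarrow> nat" where
  "age a n x = card {k\<in>{1..n}. \<forall>j\<in>{k..n}. x \<in> a j}"

definition oldest_age :: "(nat \<Rightarrow> int set) \<Rightarrow> nat \<Rightarrow> nat" where
  "oldest_age a n = Max (age a n ` a n)"

definition limit_cdf :: "real \<Rightarrow> real" where
  "limit_cdf x = (1 - exp (- x\<^sup>2)) * indicator {0<..} x"

lemma age_0: "age a 0 x = 0"
  by (simp add: age_def)

lemma age_Suc:
  assumes "x \<in> a (Suc n)"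
  shows "age a (Suc n) x = (if x \<in> a n then Suc (age a n x) else 1)"
proof -
  have fin: "finite {k\<in>{1..n}. \<forall>j\<in>{k..n}. x \<in> a j}" by simp
  have "{k\<in>{1..Suc n}. \<forall>j\<in>{k..Suc n}. x \<in> a j} =
      insert (Suc n) {k\<in>{1..n}. \<forall>j\<in>{k..n}. x \<in> a j}"
    using assms by (auto simp: le_Suc_eq)
  then have *: "age a (Suc n) x = Suc (age a n x)"
    using fin by (simp add: age_def)
  have "age a n x = 0" if "x \<notin> a n"
  proof -
    have "{k\<in>{1..n}. \<forall>j\<in>{k..n}. x \<in> a j} = {}"
      using that by auto
    then show ?thesis by (simp only: age_def card.empty)
  qed
  with * show ?thesis by simp
qed

lemma boundary_configs:
  assumes "a \<in> configs"
  shows "finite (boundary a)" "boundary a \<noteq> {}"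
proof -
  have "boundary a \<subseteq> (\<lambda>x. x + 1) ` a \<union> (\<lambda>x. x - 1) ` a"
  proof
    fix y assume "y \<in> boundary a"
    then obtain x where "x \<in> a" "y = x + 1 \<or> y = x - 1"
      unfolding boundary_def by fastforce
    then show "y \<in> (\<lambda>x. x + 1) ` a \<union> (\<lambda>x. x - 1) ` a" by blast
  qed
  then show "finite (boundary a)"
    using assms by (auto simp: configs_def intro: finite_subset)
  have fin: "finite a" "a \<noteq> {}" using assms by (auto simp: configs_def)
  have "Max a + 1 \<notin> a" using fin Max_ge by fastforce
  then have "Max a + 1 \<in> boundary a"
    using Max_in[OF fin] by (auto simp: boundary_def intro!: bexI[of _ "Max a"])
  then show "boundary a \<noteq> {}" by blast
qed

lemma set_pmf_creation:
  assumes "a \<in> configs"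
  shows "set_pmf (creation a) = (\<lambda>y. insert y a) ` boundary a"
  using boundary_configs[OF assms] by (simp add: creation_def)

lemma set_pmf_annihilation:
  assumes "a \<in> configs"
  shows "set_pmf (annihilation a) = (\<lambda>x. a - {x}) ` a"
  using assms by (simp add: annihilation_def configs_def)

lemma period_configs:
  assumes "a \<in> configs" "d \<in> set_pmf (period a)"
  shows "d \<in> configs" "card d = Suc (card a)"
proof -
  obtain b c where b: "b \<in> set_pmf (creation a)" and c: "c \<in> set_pmf (creation b)"
    and d: "d \<in> set_pmf (annihilation c)"
    using assms(2) unfolding period_def set_bind_pmf by blast
  have add: "b \<in> configs \<and> card b = Suc (card a)"
    if ab: "a \<in> configs" "b \<in> set_pmf (creation a)" for a b
  proof -
    obtain y where "y \<in> boundary a" "b = insert y a"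
      using ab(2) unfolding set_pmf_creation[OF ab(1)] by blast
    then show ?thesis using ab(1) by (simp add: configs_def boundary_def)
  qed
  have b': "b \<in> configs" "card b = Suc (card a)" using add[OF assms(1) b] by auto
  have c': "c \<in> configs" "card c = Suc (card b)" using add[OF b'(1) c] by auto
  obtain x where x: "x \<in> c" "d = c - {x}"
    using d unfolding set_pmf_annihilation[OF c'(1)] by blast
  have "finite c" using c'(1) by (simp add: configs_def)
  then show card_d: "card d = Suc (card a)" using x c' b' by simp
  then have "card d > 0" by simp
  then show "d \<in> configs" unfolding configs_def card_gt_0_iff by blast
qed

lemma mono_limit_cdf: "x \<le> y \<Longrightarrow> limit_cdf x \<le> limit_cdf y"
  by (auto simp: limit_cdf_def indicator_def power_mono)

lemma limit_cdf_eq_max: "limit_cdf x = 1 - exp (- (max x 0)\<^sup>2)"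
  by (auto simp: limit_cdf_def indicator_def max_def)

lemma limit_cdf_right_cont: "continuous (at_right x) limit_cdf"
proof -
  have "continuous_on UNIV (\<lambda>x::real. 1 - exp (- (max x 0)\<^sup>2))"
    by (intro continuous_intros)
  then have "isCont (\<lambda>x::real. 1 - exp (- (max x 0)\<^sup>2)) x"
    by (simp add: continuous_on_eq_continuous_at)
  then have "isCont limit_cdf x"
    by (simp add: limit_cdf_eq_max[abs_def])
  then show ?thesis
    by (rule continuous_at_imp_continuous_at_within)
qed

lemma limit_cdf_at_bot: "(limit_cdf \<longlongrightarrow> 0) at_bot"
proof (rule tendsto_eventually)
  show "\<forall>\<^sub>F x in at_bot. limit_cdf x = 0"
    using eventually_le_at_bot[of 0] by eventually_elim (simp add: limit_cdf_def)
qed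

lemma limit_cdf_at_top: "(limit_cdf \<longlongrightarrow> 1) at_top"
proof -
  have "((\<lambda>x::real. 1 - exp (- x\<^sup>2)) \<longlongrightarrow> 1) at_top"
  proof -
    have "filterlim (\<lambda>x::real. - x\<^sup>2) at_bot at_top"
      by (simp add: filterlim_uminus_at_bot filterlim_pow_at_top filterlim_ident)
    then have "((\<lambda>x::real. exp (- x\<^sup>2)) \<longlongrightarrow> 0) at_top"
      by (rule filterlim_compose[OF exp_at_bot])
    from tendsto_diff[OF tendsto_const[of 1] this] show ?thesis by simp
  qed
  moreover have "\<forall>\<^sub>F x in at_top. 1 - exp (- x\<^sup>2) = limit_cdf x"
    using eventually_gt_at_top[of 0] by eventually_elim (simp add: limit_cdf_def)
  ultimately show ?thesis by (rule Lim_transform_eventually)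
qed

lemma real_distribution_limit: "real_distribution (interval_measure limit_cdf)"
  by (intro real_distribution_interval_measure mono_limit_cdf limit_cdf_right_cont
      limit_cdf_at_bot limit_cdf_at_top)

lemma cdf_limit: "cdf (interval_measure limit_cdf) = limit_cdf"
  by (intro cdf_interval_measure mono_limit_cdf limit_cdf_right_cont
      limit_cdf_at_bot limit_cdf_at_top)

lemma borel_measurable_oldest_age:
  assumes "annihilation_creation_process M A"
  shows "(\<lambda>\<omega>. oldest_age (\<lambda>i. A i \<omega>) n) \<in> borel_measurable M"
proof -
  have A: "A i \<in> M \<rightarrow>\<^sub>M count_space configs" for i
    using assms by (simp add: annihilation_creation_process_def)
  have cnt: "countable configs"
    by (rule countable_subset[OF _ countable_Collect_finite]) (auto simp: configs_def)
  have mem [measurable]: "Measurable.pred M (\<lambda>\<omega>. x \<in> A i \<omega>)" for x i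
    by (rule measurable_compose[OF A]) simp
  have "(\<lambda>\<omega>. age (\<lambda>i. A i \<omega>) n x) \<in> M \<rightarrow>\<^sub>M count_space UNIV" for x
    unfolding age_def by measurable
  then have age: "(\<lambda>\<omega>. age (\<lambda>i. A i \<omega>) n x) \<in> borel_measurable M" for x
    by (rule measurable_compose) simp
  have "(\<lambda>\<omega>. Max ((\<lambda>x. age (\<lambda>i. A i \<omega>) n x) ` c)) \<in> borel_measurable M"
    if "c \<in> configs" for c
    using that age by (intro borel_measurable_Max) (auto simp: configs_def)
  from measurable_compose_countable'[OF this A cnt] show ?thesis
    by (simp add: oldest_age_def)
qed

end

theory Submission
  imports Defs "HOL-Real_Asymp.Real_Asymp"
begin

text \<open>
  For \<open>1 \<le> m \<le> n\<close> the age of the oldest particle at time n is at most \<open>n - m\<close> iff none of the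
  \<open>m + 1\<close> particles present at time m is still there at time n, i.e. iff no site is occupied
  throughout the times m, ..., n (\<open>oldest_age_le_iff\<close>).

  Wherever the additions place their particles, the deletion of period i picks uniformly one of
  \<open>i + 2\<close> particles. So the number N of survivors among the particles present at time m is a pure
  death chain that loses a particle with probability \<open>N / (i + 2)\<close> in period i. Any k given
  particles present at time j all survive until time n with a probability that telescopes: the
  product of \<open>1 - k / (i + 2)\<close> over \<open>j < i \<le> n\<close> is \<open>(j + 2 choose k) / (n + 2 choose k)\<close>,
  which is also the probability that a random k-element subset of \<open>{1..n + 2}\<close> lies in
  \<open>{1..j + 2}\<close>. By inclusion-exclusion, r particles present at time j are all gone at time n with
  the probability that a random r-element subset of \<open>{1..n + 2}\<close> misses \<open>{1..j + 2}\<close>, namely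
  \<open>(n - j choose r) / (n + 2 choose r)\<close>. This is \<open>extinction_prob\<close>. The formal proof turns the guess
  around: evaluated along the death chain, \<open>extinction_prob\<close> is a martingale
  (\<open>extinction_prob_step\<close>) whose value at time n is the indicator of extinction, and backward
  induction along the paths of the chain shows that its value at time m is the probability sought
  (\<open>prob_extinction\<close>).

  With \<open>r = m + 1\<close> the quotient of binomial coefficients is a product of \<open>m + 1\<close> factors
  \<open>1 - (m + 2) / (n + 2 - i)\<close>, which lies between two exponentials
  (\<open>extinction_prob_bounds\<close>). If \<open>m / sqrt n\<close> tends to x, both exponents tend to \<open>- x\<^sup>2\<close>.
\<close>

section \<open>The extinction probability of the death chain\<close>

definition extinction_prob :: "nat \<Rightarrow> nat \<Rightarrow> nat \<Rightarrow> real" where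
  "extinction_prob n j r = real ((n - j) choose r) / real ((n + 2) choose r)"

lemma extinction_prob_final: "extinction_prob n n r = (if r = 0 then 1 else 0)"
  by (simp add: extinction_prob_def binomial_eq_0_iff)

lemma Suc_times_choose_Suc:
  "real (Suc k) * real (n choose Suc k) = (real n - real k) * real (n choose k)"
proof (cases "k \<le> n")
  case True
  have "Suc k * (n choose Suc k) = (n - k) * (n choose k)"
    by (simp only: binomial_absorption binomial_absorb_comp)
  then have "real (Suc k * (n choose Suc k)) = real ((n - k) * (n choose k))" by (rule arg_cong)
  then show ?thesis using True by (simp only: of_nat_mult of_nat_diff)
qed (simp add: binomial_eq_0)

text \<open>
  The martingale property: at time j there are r marked particles, and the deletion of period
  \<open>j + 1\<close> hits one of them with probability \<open>r / (j + 3)\<close>. Written with \<open>d = n - j - 1\<close>, the identity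
  reduces to Pascal's rule for \<open>d + 1 choose r\<close> and to the ratio of consecutive binomial
  coefficients, for d and for \<open>n + 2\<close>.
\<close>

lemma extinction_prob_step:
  assumes "j < n" "r \<le> j + 3"
  shows "extinction_prob n j r =
    (1 - real r / (real j + 3)) * extinction_prob n (Suc j) r +
    real r / (real j + 3) * extinction_prob n (Suc j) (r - 1)"
proof (cases r)
  case 0
  then show ?thesis by (simp add: extinction_prob_def)
next
  case (Suc q)
  define d where "d = n - Suc j"
  have d: "n - j = Suc d" "real n = real d + real j + 1" using assms by (auto simp: d_def)
  define B C :: real where "B = real (d choose Suc q)" and "C = real (d choose q)"
  define D E :: real where "D = real ((n + 2) choose Suc q)" and "E = real ((n + 2) choose q)"
  have nz: "D \<noteq> 0" "E \<noteq> 0" using assms Suc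
    by (simp_all only: D_def E_def of_nat_eq_0_iff binomial_eq_0_iff not_less)
  have BC: "real (Suc q) * B = (real d - real q) * C"
    unfolding B_def C_def by (rule Suc_times_choose_Suc)
  have "real (Suc q) * D = (real (n + 2) - real q) * E"
    unfolding D_def E_def by (rule Suc_times_choose_Suc)
  then have DE: "real (Suc q) * (C / E) = (real n + 2 - real q) * (C / D)"
    using nz by (simp add: divide_simps)
  \<comment> \<open>\<open>B + C\<close> is \<open>d + 1 choose r\<close> by Pascal's rule.\<close>
  have "(real j + 3) * ((B + C) / D) =
      (real j + 3 - real (Suc q)) * (B / D) + (real n + 2 - real q) * (C / D)"
    using BC nz unfolding d by (simp add: divide_simps) (simp add: algebra_simps)
  also have "\<dots> = (real j + 3 - real (Suc q)) * (B / D) + real (Suc q) * (C / E)"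
    by (simp only: DE)
  finally have scaled: "(real j + 3) * ((B + C) / D) =
      (real j + 3 - real (Suc q)) * (B / D) + real (Suc q) * (C / E)" .
  have unscale: "z = (1 - s / k) * x + s / k * y"
    if "k * z = (k - s) * x + s * y" "k \<noteq> 0" for k s x y z :: real
  proof -
    have "z = ((k - s) * x + s * y) / k" using that by (simp add: field_simps)
    also have "\<dots> = (1 - s / k) * x + s / k * y" using that(2) by (simp add: field_simps)
    finally show ?thesis .
  qed
  have "(B + C) / D =
      (1 - real (Suc q) / (real j + 3)) * (B / D) + real (Suc q) / (real j + 3) * (C / E)"
    by (rule unscale[OF scaled]) simp
  then show ?thesis
    using d(1) by (simp add: extinction_prob_def Suc B_def C_def D_def E_def d_def add.commute)
qed

section \<open>One period seen by a set of marked particles\<close>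

text \<open>
  For integrating out the two additions of a period, whose outcome does not influence how many
  marked particles the deletion removes.
\<close>

lemma expectation_bind_const:
  fixes h :: "'b \<Rightarrow> real"
  assumes "finite (set_pmf p)" "\<And>x. x \<in> set_pmf p \<Longrightarrow> finite (set_pmf (f x))"
    and "\<And>x. x \<in> set_pmf p \<Longrightarrow> measure_pmf.expectation (f x) h = c"
  shows "measure_pmf.expectation (p \<bind> f) h = c"
  using assms by (subst pmf_expectation_bind[of "set_pmf p"])
    (auto simp: sum_pmf_eq_1 simp flip: sum_distrib_right)

lemma creation_grows:
  assumes "a \<in> configs" "b \<in> set_pmf (creation a)"
  shows "b \<in> configs" "a \<subseteq> b" "card b = Suc (card a)"
  using assms by (auto simp: set_pmf_creation configs_def boundary_def)

lemma finite_creation: "a \<in> configs \<Longrightarrow> finite (set_pmf (creation a))"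
  by (simp add: set_pmf_creation boundary_configs)

lemma finite_annihilation: "a \<in> configs \<Longrightarrow> finite (set_pmf (annihilation a))"
  by (simp add: set_pmf_annihilation) (simp add: configs_def)

lemma finite_period: "a \<in> configs \<Longrightarrow> finite (set_pmf (period a))"
  unfolding period_def set_bind_pmf
  by (intro finite_UN_I finite_creation finite_annihilation) (auto dest: creation_grows(1))

text \<open>
  The site x deleted from c lies in S with probability \<open>card S / card c\<close>, and only then
  does S lose an element.
\<close>

lemma expectation_annihilation:
  fixes f :: "nat \<Rightarrow> real"
  assumes "c \<in> configs" "S \<subseteq> c"
  shows "measure_pmf.expectation (annihilation c) (\<lambda>s. f (card (S \<inter> s))) =
    (1 - card S / card c) * f (card S) + card S / card c * f (card S - 1)"
proof -
  have c: "finite c" "c \<noteq> {}" "card c > 0" and S: "finite S"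
    using assms by (auto simp: configs_def card_gt_0_iff intro: finite_subset)
  have le: "card S \<le> card c" using assms c by (simp add: card_mono)
  have "(\<Sum>x\<in>c. f (card (S \<inter> (c - {x})))) =
      (\<Sum>x\<in>c - S. f (card (S \<inter> (c - {x})))) + (\<Sum>x\<in>S. f (card (S \<inter> (c - {x}))))"
    using c assms by (simp add: sum.subset_diff)
  also have "(\<Sum>x\<in>c - S. f (card (S \<inter> (c - {x})))) = (\<Sum>x\<in>c - S. f (card S))"
    using assms by (intro sum.cong refl arg_cong[where f="\<lambda>S. f (card S)"]) auto
  also have "(\<Sum>x\<in>S. f (card (S \<inter> (c - {x})))) = (\<Sum>x\<in>S. f (card (S - {x})))"
    using assms by (intro sum.cong refl arg_cong[where f="\<lambda>S. f (card S)"]) auto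
  also have "\<dots> = (\<Sum>x\<in>S. f (card S - 1))"
    using S by (intro sum.cong refl) simp
  finally have "(\<Sum>x\<in>c. f (card (S \<inter> (c - {x})))) =
      (real (card c) - card S) * f (card S) + card S * f (card S - 1)"
    using S c assms le by (simp add: card_Diff_subset of_nat_diff)
  then show ?thesis
    using c by (simp add: annihilation_def integral_pmf_of_set field_simps)
qed

text \<open>
  Additions never touch the sites of S, so only the deletion from \<open>card a + 2\<close> particles matters:
  this is the transition law of the death chain.
\<close>

lemma expectation_period:
  fixes f :: "nat \<Rightarrow> real"
  assumes "a \<in> configs" "S \<subseteq> a"
  shows "measure_pmf.expectation (period a) (\<lambda>s. f (card (S \<inter> s))) =
    (1 - card S / (card a + 2)) * f (card S) + card S / (card a + 2) * f (card S - 1)"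
  unfolding period_def
proof (rule expectation_bind_const[OF finite_creation[OF assms(1)]])
  fix b assume "b \<in> set_pmf (creation a)"
  note b = creation_grows[OF assms(1) this]
  show "measure_pmf.expectation (creation b \<bind> annihilation) (\<lambda>s. f (card (S \<inter> s))) =
    (1 - card S / (card a + 2)) * f (card S) + card S / (card a + 2) * f (card S - 1)"
  proof (rule expectation_bind_const[OF finite_creation[OF b(1)]])
    fix c assume "c \<in> set_pmf (creation b)"
    note c = creation_grows[OF b(1) this]
    show "finite (set_pmf (annihilation c))" using finite_annihilation c(1) .
    have "S \<subseteq> c" using assms b c by blast
    from expectation_annihilation[OF c(1) this, of f]
    show "measure_pmf.expectation (annihilation c) (\<lambda>s. f (card (S \<inter> s))) =
      (1 - card S / (card a + 2)) * f (card S) + card S / (card a + 2) * f (card S - 1)"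
      using b c by (simp add: algebra_simps)
  qed
  show "finite (set_pmf (creation b \<bind> annihilation))"
    using creation_grows[OF b(1)] finite_creation[OF b(1)] finite_annihilation
    by (auto simp: set_bind_pmf)
qed

section \<open>The oldest particle and the permanently occupied sites\<close>

text \<open>
  These are the sites of the particles that were present at time m and survived until time n,
  because both additions of a period precede its deletion, so that a site occupied at successive
  times carries the same particle at both.
\<close>

definition permanent_sites :: "nat \<Rightarrow> nat \<Rightarrow> (nat \<Rightarrow> int set) \<Rightarrow> int set" where
  "permanent_sites m n a = (\<Inter>i\<in>{m..n}. a i)"

lemma permanent_sites_Suc:
  "m \<le> Suc n \<Longrightarrow> permanent_sites m (Suc n) a = permanent_sites m n a \<inter> a (Suc n)"
  by (simp add: permanent_sites_def atLeastAtMostSuc_conv Int_commute)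

lemma permanent_sites_cong:
  "(\<And>i. i \<le> n \<Longrightarrow> a i = b i) \<Longrightarrow> permanent_sites m n a = permanent_sites m n b"
  by (simp add: permanent_sites_def)

text \<open>
  The periods counted by the age form a final segment of \<open>{1..n}\<close>, hence the age exceeds \<open>n - m\<close> iff
  the segment reaches back to m. The condition \<open>1 \<le> m\<close> reflects that the initial particle and the
  ones added in period 1 have seen the same deletions.
\<close>

lemma age_gt_iff:
  assumes "1 \<le> m" "m \<le> n"
  shows "n - m < age a n x \<longleftrightarrow> x \<in> permanent_sites m n a"
proof
  assume "x \<in> permanent_sites m n a"
  then have "{m..n} \<subseteq> {k\<in>{1..n}. \<forall>j\<in>{k..n}. x \<in> a j}"
    using assms by (auto simp: permanent_sites_def)
  then have "card {m..n} \<le> age a n x" unfolding age_def by (intro card_mono) auto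
  then show "n - m < age a n x" using assms by simp
next
  assume *: "n - m < age a n x"
  have "\<not> {k\<in>{1..n}. \<forall>j\<in>{k..n}. x \<in> a j} \<subseteq> {Suc m..n}"
  proof
    assume "{k\<in>{1..n}. \<forall>j\<in>{k..n}. x \<in> a j} \<subseteq> {Suc m..n}"
    then have "age a n x \<le> card {Suc m..n}" unfolding age_def by (intro card_mono) auto
    then show False using * by simp
  qed
  then obtain k where "k \<le> m" "\<forall>j\<in>{k..n}. x \<in> a j" by force
  then show "x \<in> permanent_sites m n a" by (auto simp: permanent_sites_def)
qed

lemma oldest_age_le_iff:
  assumes "1 \<le> m" "m \<le> n" "a n \<in> configs"
  shows "oldest_age a n \<le> n - m \<longleftrightarrow> permanent_sites m n a = {}"
proof -
  have "oldest_age a n \<le> n - m \<longleftrightarrow> (\<forall>x\<in>a n. age a n x \<le> n - m)"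
    using assms(3) by (simp add: oldest_age_def configs_def)
  also have "\<dots> \<longleftrightarrow> (\<forall>x\<in>a n. x \<notin> permanent_sites m n a)"
    using age_gt_iff[OF assms(1,2), of a] by (auto simp: not_less[symmetric])
  also have "\<dots> \<longleftrightarrow> permanent_sites m n a = {}"
    using assms(2) by (auto simp: permanent_sites_def)
  finally show ?thesis .
qed

lemma oldest_age_le:
  assumes "a n \<in> configs"
  shows "oldest_age a n \<le> n"
proof -
  have "age a n x \<le> card {1..n}" for x unfolding age_def by (intro card_mono) auto
  then show ?thesis using assms by (simp add: oldest_age_def configs_def)
qed

section \<open>Extinction along the paths of the process\<close>

context
  fixes M :: "'w measure" and A :: "nat \<Rightarrow> 'w \<Rightarrow> int set"
  assumes process: "annihilation_creation_process M A"
begin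

interpretation prob_space M
  using process by (simp add: annihilation_creation_process_def)

lemma measurable_process: "A n \<in> M \<rightarrow>\<^sub>M count_space configs"
  using process by (simp add: annihilation_creation_process_def)

lemma process_configs: "\<omega> \<in> space M \<Longrightarrow> A n \<omega> \<in> configs"
  using measurable_space[OF measurable_process] by simp

lemma pred_process [measurable]: "Measurable.pred M (\<lambda>\<omega>. Q (A n \<omega>))"
  by (rule measurable_compose[OF measurable_process]) simp

lemma markov_property:
  assumes "\<P>(\<omega> in M. \<forall>i\<le>n. A i \<omega> = a i) > 0"
  shows "\<P>(\<omega> in M. \<forall>i\<le>Suc n. A i \<omega> = a i) =
    \<P>(\<omega> in M. \<forall>i\<le>n. A i \<omega> = a i) * pmf (period (a n)) (a (Suc n))"
proof -
  have "\<P>(\<omega> in M. A (Suc n) \<omega> = a (Suc n) \<bar> \<forall>i\<le>n. A i \<omega> = a i) =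
      pmf (period (a n)) (a (Suc n))"
    using process assms unfolding annihilation_creation_process_def by blast
  moreover have "\<P>(\<omega> in M. \<forall>i\<le>Suc n. A i \<omega> = a i) =
      \<P>(\<omega> in M. A (Suc n) \<omega> = a (Suc n) \<and> (\<forall>i\<le>n. A i \<omega> = a i))"
    by (rule arg_cong[where f="measure M"]) (auto simp: le_Suc_eq)
  ultimately show ?thesis using assms by (simp add: cond_prob_def field_simps)
qed

text \<open>
  Paths of positive probability grow by exactly one particle per period; their last state
  determines the number \<open>n + 1\<close> of particles that enters the deletion probabilities.
\<close>

lemma possible_path:
  assumes "\<P>(\<omega> in M. \<forall>i\<le>n. A i \<omega> = a i) > 0"
  shows "a n \<in> configs" "card (a n) = Suc n"
proof -
  have "a n \<in> configs \<and> card (a n) = Suc n"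
    using assms
  proof (induction n)
    case 0
    have "AE \<omega> in M. A 0 \<omega> = {0}"
      using process by (simp add: annihilation_creation_process_def)
    have "a 0 = {0}"
    proof (rule ccontr)
      assume "a 0 \<noteq> {0}"
      then have "AE \<omega> in M. \<not> (\<forall>i\<le>0. A i \<omega> = a i)"
        using \<open>AE \<omega> in M. A 0 \<omega> = {0}\<close> by (auto elim!: eventually_mono)
      then have "\<P>(\<omega> in M. \<forall>i\<le>0. A i \<omega> = a i) = 0"
        by (rule prob_eq_0_AE)
      then show False using 0 by simp
    qed
    then show ?case by (simp add: configs_def)
  next
    case (Suc n)
    have "\<P>(\<omega> in M. \<forall>i\<le>Suc n. A i \<omega> = a i) \<le> \<P>(\<omega> in M. \<forall>i\<le>n. A i \<omega> = a i)"
      by (intro finite_measure_mono) auto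
    with Suc.prems have pos: "\<P>(\<omega> in M. \<forall>i\<le>n. A i \<omega> = a i) > 0" by linarith
    then have "pmf (period (a n)) (a (Suc n)) \<noteq> 0"
      using Suc.prems markov_property[OF pos] by auto
    then have "a (Suc n) \<in> set_pmf (period (a n))" by (simp add: set_pmf_iff)
    with period_configs Suc.IH[OF pos] show ?case by auto
  qed
  then show "a n \<in> configs" "card (a n) = Suc n" by auto
qed

text \<open>
  First-step analysis in a form without conditional probabilities. An event E may depend on the
  whole future; if its probability on each one-step extension s of a path is a multiple \<open>h s\<close> of the
  probability of the extended path, then on the path itself the multiple is the mean of h under the
  transition law.
\<close>

lemma first_step:
  assumes pos: "\<P>(\<omega> in M. \<forall>i\<le>n. A i \<omega> = a i) > 0"
    and E [measurable]: "Measurable.pred M E"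
    and step: "\<And>s. s \<in> set_pmf (period (a n)) \<Longrightarrow>
      \<P>(\<omega> in M. E \<omega> \<and> (\<forall>i\<le>Suc n. A i \<omega> = (a(Suc n := s)) i)) =
      \<P>(\<omega> in M. \<forall>i\<le>Suc n. A i \<omega> = (a(Suc n := s)) i) * h s"
  shows "\<P>(\<omega> in M. E \<omega> \<and> (\<forall>i\<le>n. A i \<omega> = a i)) =
    \<P>(\<omega> in M. \<forall>i\<le>n. A i \<omega> = a i) * measure_pmf.expectation (period (a n)) h"
proof -
  let ?P = "\<P>(\<omega> in M. \<forall>i\<le>n. A i \<omega> = a i)"
  let ?S = "set_pmf (period (a n))"
  have fin: "finite ?S" using finite_period possible_path(1)[OF pos] .
  have path: "(\<forall>i\<le>Suc n. A i \<omega> = (a(Suc n := s)) i) \<longleftrightarrow>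
      (\<forall>i\<le>n. A i \<omega> = a i) \<and> A (Suc n) \<omega> = s" for \<omega> s
    by (auto simp: le_Suc_eq)
  have upd: "\<P>(\<omega> in M. \<forall>i\<le>n. A i \<omega> = (a(Suc n := s)) i) = ?P" for s
    by (rule arg_cong[where f="measure M"]) auto
  have weight: "\<P>(\<omega> in M. \<forall>i\<le>Suc n. A i \<omega> = (a(Suc n := s)) i) = ?P * pmf (period (a n)) s" for s
    using markov_property[of n "a(Suc n := s)"] pos unfolding upd by simp
  \<comment> \<open>The finitely many possible successors exhaust the path, as their weights add up to one.\<close>
  have "\<P>(\<omega> in M. (\<forall>i\<le>n. A i \<omega> = a i) \<and> A (Suc n) \<omega> \<in> ?S) =
      (\<Sum>s\<in>?S. \<P>(\<omega> in M. \<forall>i\<le>Suc n. A i \<omega> = (a(Suc n := s)) i))"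
    unfolding path by (rule prob_sum[OF fin]) (measurable, auto)
  also have "\<dots> = ?P"
    unfolding weight by (simp add: sum_distrib_left[symmetric] sum_pmf_eq_1[OF fin])
  finally have stays: "\<P>(\<omega> in M. (\<forall>i\<le>n. A i \<omega> = a i) \<and> A (Suc n) \<omega> \<in> ?S) = ?P" .
  have "\<P>(\<omega> in M. (\<forall>i\<le>n. A i \<omega> = a i) \<and> A (Suc n) \<omega> \<notin> ?S) =
      \<P>(\<omega> in M. \<forall>i\<le>n. A i \<omega> = a i) -
      \<P>(\<omega> in M. (\<forall>i\<le>n. A i \<omega> = a i) \<and> A (Suc n) \<omega> \<in> ?S)"
    by (subst finite_measure_Diff[symmetric]) (auto intro!: arg_cong[where f="measure M"])
  then have "AE \<omega> in M. (\<forall>i\<le>n. A i \<omega> = a i) \<longrightarrow> A (Suc n) \<omega> \<in> ?S"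
    unfolding stays by (subst (asm) diff_self, subst (asm) prob_Collect_eq_0) auto
  then have "\<P>(\<omega> in M. E \<omega> \<and> (\<forall>i\<le>n. A i \<omega> = a i)) =
      (\<Sum>s\<in>?S. \<P>(\<omega> in M. E \<omega> \<and> (\<forall>i\<le>Suc n. A i \<omega> = (a(Suc n := s)) i)))"
    unfolding path by (intro prob_sum[OF fin]) (measurable, auto)
  also have "\<dots> = (\<Sum>s\<in>?S. ?P * (h s * pmf (period (a n)) s))"
    by (intro sum.cong refl) (simp only: step weight mult_ac)
  also have "\<dots> = ?P * measure_pmf.expectation (period (a n)) h"
    using fin by (simp add: integral_measure_pmf_real[OF fin] sum_distrib_left)
  finally show ?thesis .
qed

lemma impossible_path:
  assumes "\<not> \<P>(\<omega> in M. \<forall>i\<le>n. A i \<omega> = a i) > 0"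
  shows "\<P>(\<omega> in M. \<forall>i\<le>n. A i \<omega> = a i) = 0"
    "\<P>(\<omega> in M. E \<omega> \<and> (\<forall>i\<le>n. A i \<omega> = a i)) = 0"
proof -
  show *: "\<P>(\<omega> in M. \<forall>i\<le>n. A i \<omega> = a i) = 0"
    using assms by (simp add: zero_less_measure_iff)
  have "\<P>(\<omega> in M. E \<omega> \<and> (\<forall>i\<le>n. A i \<omega> = a i)) \<le> \<P>(\<omega> in M. \<forall>i\<le>n. A i \<omega> = a i)"
    by (intro finite_measure_mono) auto
  then show "\<P>(\<omega> in M. E \<omega> \<and> (\<forall>i\<le>n. A i \<omega> = a i)) = 0"
    using * by (simp add: measure_le_0_iff)
qed

lemma pred_permanent_sites [measurable]:
  "Measurable.pred M (\<lambda>\<omega>. permanent_sites m n (\<lambda>i. A i \<omega>) = {})"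
proof -
  have "Measurable.pred M (\<lambda>\<omega>. \<forall>x. \<exists>i\<in>{m..n}. x \<notin> A i \<omega>)" by measurable
  then show ?thesis by (simp add: permanent_sites_def set_eq_iff)
qed

text \<open>
  Backward induction from time n, where \<open>extinction_prob\<close> is the indicator of extinction; each step
  is the martingale property combined with the transition law of the death chain.
\<close>

lemma prob_extinction_given_path:
  assumes "m \<le> j" "j \<le> n"
  shows "\<P>(\<omega> in M. permanent_sites m n (\<lambda>i. A i \<omega>) = {} \<and> (\<forall>i\<le>j. A i \<omega> = a i)) =
    \<P>(\<omega> in M. \<forall>i\<le>j. A i \<omega> = a i) * extinction_prob n j (card (permanent_sites m j a))"
  using assms(2,1)
proof (induction j arbitrary: a rule: inc_induct)
  case base
  have sites: "permanent_sites m n (\<lambda>i. A i \<omega>) = permanent_sites m n a"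
    if "\<forall>i\<le>n. A i \<omega> = a i" for \<omega>
    using that by (intro permanent_sites_cong) auto
  have "finite (permanent_sites m n a)" if "\<P>(\<omega> in M. \<forall>i\<le>n. A i \<omega> = a i) > 0"
    using possible_path(1)[OF that] base
    by (auto simp: configs_def permanent_sites_def intro!: finite_subset[of _ "a n"])
  moreover have "{\<omega> \<in> space M. permanent_sites m n (\<lambda>i. A i \<omega>) = {} \<and> (\<forall>i\<le>n. A i \<omega> = a i)} =
      (if permanent_sites m n a = {} then {\<omega> \<in> space M. \<forall>i\<le>n. A i \<omega> = a i} else {})"
    using sites by auto
  ultimately show ?case
    using impossible_path(1)[of n a]
    by (cases "\<P>(\<omega> in M. \<forall>i\<le>n. A i \<omega> = a i) > 0") (auto simp: extinction_prob_final)
next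
  case (step j)
  let ?S = "permanent_sites m j a"
  show ?case
  proof (cases "\<P>(\<omega> in M. \<forall>i\<le>j. A i \<omega> = a i) > 0")
    case True
    note a = possible_path[OF True]
    have sub: "?S \<subseteq> a j" using step by (auto simp: permanent_sites_def)
    then have le: "card ?S \<le> Suc j"
      using a by (metis card_mono configs_def mem_Collect_eq)
    have "permanent_sites m (Suc j) (a(Suc j := s)) = ?S \<inter> s" for s
      using step permanent_sites_cong[of j "a(Suc j := s)" a m] by (simp add: permanent_sites_Suc)
    then have "\<P>(\<omega> in M. permanent_sites m n (\<lambda>i. A i \<omega>) = {} \<and> (\<forall>i\<le>j. A i \<omega> = a i)) =
        \<P>(\<omega> in M. \<forall>i\<le>j. A i \<omega> = a i) *
        measure_pmf.expectation (period (a j)) (\<lambda>s. extinction_prob n (Suc j) (card (?S \<inter> s)))"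
      using step by (intro first_step[OF True]) (simp_all del: fun_upd_apply)
    also have "measure_pmf.expectation (period (a j))
        (\<lambda>s. extinction_prob n (Suc j) (card (?S \<inter> s))) = extinction_prob n j (card ?S)"
      using extinction_prob_step[of j n "card ?S"] step le
      by (subst expectation_period[OF a(1) sub]) (simp add: a(2) add_ac)
    finally show ?thesis .
  qed (simp add: impossible_path)
qed

text \<open>
  At time m the marked particles are all \<open>m + 1\<close> particles present, so the value at time m does not
  depend on the path. Being constant, it is carried back by first-step analysis to time 0, where
  the path is almost surely \<open>{0}\<close>; this replaces a summation over all paths up to time m.
\<close>

lemma prob_extinction:
  assumes "m \<le> n"
  shows "\<P>(\<omega> in M. permanent_sites m n (\<lambda>i. A i \<omega>) = {}) = extinction_prob n m (Suc m)"
proof -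
  have "\<P>(\<omega> in M. permanent_sites m n (\<lambda>i. A i \<omega>) = {} \<and> (\<forall>i\<le>j. A i \<omega> = a i)) =
    \<P>(\<omega> in M. \<forall>i\<le>j. A i \<omega> = a i) * extinction_prob n m (Suc m)" if "j \<le> m" for j a
    using that
  proof (induction j arbitrary: a rule: inc_induct)
    case base
    have "card (permanent_sites m m a) = Suc m" if "\<P>(\<omega> in M. \<forall>i\<le>m. A i \<omega> = a i) > 0"
      using possible_path(2)[OF that] by (simp add: permanent_sites_def)
    then show ?case
      using prob_extinction_given_path[of m m n a] impossible_path[of m a] assms by fastforce
  next
    case (step j)
    show ?case
    proof (cases "\<P>(\<omega> in M. \<forall>i\<le>j. A i \<omega> = a i) > 0")
      case True
      then show ?thesis
        using first_step[OF True, where h="\<lambda>_. extinction_prob n m (Suc m)"] step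
        by (simp del: fun_upd_apply)
    qed (simp add: impossible_path)
  qed
  from this[of 0 "\<lambda>_. {0}"]
  have *: "\<P>(\<omega> in M. permanent_sites m n (\<lambda>i. A i \<omega>) = {} \<and> A 0 \<omega> = {0}) =
    \<P>(\<omega> in M. A 0 \<omega> = {0}) * extinction_prob n m (Suc m)" by simp
  have start: "AE \<omega> in M. A 0 \<omega> = {0}"
    using process by (simp add: annihilation_creation_process_def)
  then have "\<P>(\<omega> in M. A 0 \<omega> = {0}) = 1" by (subst prob_Collect_eq_1) auto
  moreover have "\<P>(\<omega> in M. permanent_sites m n (\<lambda>i. A i \<omega>) = {} \<and> A 0 \<omega> = {0}) =
      \<P>(\<omega> in M. permanent_sites m n (\<lambda>i. A i \<omega>) = {})"
    using start by (intro prob_eq_AE) auto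
  ultimately show ?thesis using * by simp
qed

text \<open>
  The integer \<open>n - O\<close>, with O the age of the oldest particle, exceeds y iff it is at least
  \<open>m = nat \<lfloor>y\<rfloor> + 1\<close>. As m is positive even for \<open>0 \<le> y < 1\<close>, this event is the extinction of the
  particles present at time m.
\<close>

lemma prob_oldest_age:
  assumes "0 \<le> y" "nat \<lfloor>y\<rfloor> < n"
  shows "\<P>(\<omega> in M. real n - real (oldest_age (\<lambda>i. A i \<omega>) n) \<le> y) =
    1 - extinction_prob n (Suc (nat \<lfloor>y\<rfloor>)) (Suc (Suc (nat \<lfloor>y\<rfloor>)))"
proof -
  let ?m = "Suc (nat \<lfloor>y\<rfloor>)"
  have iff: "real n - real (oldest_age (\<lambda>i. A i \<omega>) n) \<le> y \<longleftrightarrow>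
      permanent_sites ?m n (\<lambda>i. A i \<omega>) \<noteq> {}" if "\<omega> \<in> space M" for \<omega>
  proof -
    let ?O = "oldest_age (\<lambda>i. A i \<omega>) n"
    note c = process_configs[OF that, of n]
    have "?O \<le> n" using oldest_age_le[of "\<lambda>i. A i \<omega>" n] c .
    then have "real n - real ?O = of_int (int (n - ?O))" by (simp add: of_nat_diff)
    then have "real n - real ?O \<le> y \<longleftrightarrow> int (n - ?O) \<le> \<lfloor>y\<rfloor>" by (simp only: le_floor_iff)
    also have "\<dots> \<longleftrightarrow> \<not> ?O \<le> n - ?m" using assms \<open>?O \<le> n\<close> by linarith
    also have "\<dots> \<longleftrightarrow> permanent_sites ?m n (\<lambda>i. A i \<omega>) \<noteq> {}"
      using oldest_age_le_iff[of ?m n "\<lambda>i. A i \<omega>"] assms c by simp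
    finally show ?thesis .
  qed
  have "\<P>(\<omega> in M. real n - real (oldest_age (\<lambda>i. A i \<omega>) n) \<le> y) =
      \<P>(\<omega> in M. \<not> permanent_sites ?m n (\<lambda>i. A i \<omega>) = {})"
    using iff by (intro arg_cong[where f="measure M"]) auto
  also have "\<dots> = 1 - \<P>(\<omega> in M. permanent_sites ?m n (\<lambda>i. A i \<omega>) = {})"
    by (rule prob_neg) measurable
  finally show ?thesis using assms by (simp add: prob_extinction)
qed

end

section \<open>Asymptotics of the extinction probability\<close>

lemma extinction_prob_prod:
  assumes "2 * m < n"
  shows "extinction_prob n m (Suc m) =
    (\<Prod>i\<le>m. (real n - real m - real i) / (real n + 2 - real i))"
proof -
  have "extinction_prob n m (Suc m) =
      (\<Prod>i<Suc m. real (n - m - i) / real (Suc m - i)) / (\<Prod>i<Suc m. real (n + 2 - i) / real (Suc m - i))"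
    using assms unfolding extinction_prob_def
    by (subst (1 2) binomial_altdef_of_nat) (auto simp: atLeast0LessThan)
  also have "\<dots> = (\<Prod>i<Suc m. (real (n - m - i) / real (Suc m - i)) / (real (n + 2 - i) / real (Suc m - i)))"
    by (rule prod_dividef[symmetric])
  also have "\<dots> = (\<Prod>i<Suc m. (real n - real m - real i) / (real n + 2 - real i))"
  proof (rule prod.cong[OF refl])
    fix i assume "i \<in> {..<Suc m}"
    then have "real (n - m - i) = real n - real m - real i" "real (n + 2 - i) = real n + 2 - real i"
      "real (Suc m - i) \<noteq> 0"
      using assms by (auto simp: of_nat_diff)
    then show "(real (n - m - i) / real (Suc m - i)) / (real (n + 2 - i) / real (Suc m - i)) =
        (real n - real m - real i) / (real n + 2 - real i)" by (simp del: of_nat_diff)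
  qed
  finally show ?thesis by (simp only: lessThan_Suc_atMost)
qed

text \<open>
  Both bounds are \<open>1 + t \<le> exp t\<close>, applied to each factor
  \<open>1 - (m + 2) / (n + 2 - i)\<close> for the upper bound and to its inverse
  \<open>1 + (m + 2) / (n - m - i)\<close> for the lower one.
\<close>

lemma extinction_prob_bounds:
  assumes "2 * m < n"
  shows "extinction_prob n m (Suc m) \<le> exp (- ((real m + 1) * (real m + 2) / (real n + 2)))"
    and "exp (- ((real m + 1) * (real m + 2) / (real n - 2 * real m))) \<le> extinction_prob n m (Suc m)"
proof -
  have mn: "2 * real m < real n" using assms by linarith
  let ?f = "\<lambda>i. (real n - real m - real i) / (real n + 2 - real i)"
  have pow: "exp (- ((real m + 1) * (real m + 2) / c)) = (\<Prod>i\<le>m. exp (- ((real m + 2) / c)))" for c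
  proof -
    have "(\<Prod>i\<le>m. exp (- ((real m + 2) / c))) = exp (real (Suc m) * - ((real m + 2) / c))"
      by (simp only: prod_constant card_atMost exp_of_nat_mult)
    then show ?thesis by (simp add: add.commute)
  qed
  have "?f i \<le> exp (- ((real m + 2) / (real n + 2)))" if "i \<le> m" for i
  proof -
    have i: "real i \<le> real m" using that by simp
    have "?f i = 1 + (- ((real m + 2) / (real n + 2 - real i)))"
      using i mn by (simp add: field_simps)
    also have "\<dots> \<le> exp (- ((real m + 2) / (real n + 2 - real i)))" by (rule exp_ge_add_one_self)
    also have "\<dots> \<le> exp (- ((real m + 2) / (real n + 2)))"
      using i mn by (simp add: divide_left_mono)
    finally show ?thesis .
  qed
  then show "extinction_prob n m (Suc m) \<le> exp (- ((real m + 1) * (real m + 2) / (real n + 2)))"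
    unfolding extinction_prob_prod[OF assms] pow
    using mn by (intro prod_mono) auto
  have "exp (- ((real m + 2) / (real n - 2 * real m))) \<le> ?f i" if "i \<le> m" for i
  proof -
    have i: "real i \<le> real m" using that by simp
    have "inverse (?f i) = 1 + (real m + 2) / (real n - real m - real i)"
      using i mn by (simp add: field_simps)
    also have "\<dots> \<le> exp ((real m + 2) / (real n - real m - real i))" by (rule exp_ge_add_one_self)
    also have "\<dots> \<le> exp ((real m + 2) / (real n - 2 * real m))"
      using i mn by (simp add: divide_left_mono)
    finally have "inverse (?f i) \<le> exp ((real m + 2) / (real n - 2 * real m))" .
    moreover have "0 < inverse (?f i)"
      using i mn by (intro positive_imp_inverse_positive divide_pos_pos) linarith+
    ultimately have "inverse (exp ((real m + 2) / (real n - 2 * real m))) \<le> inverse (inverse (?f i))"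
      by (rule le_imp_inverse_le)
    then show ?thesis by (simp only: exp_minus inverse_inverse_eq)
  qed
  then show "exp (- ((real m + 1) * (real m + 2) / (real n - 2 * real m))) \<le> extinction_prob n m (Suc m)"
    unfolding extinction_prob_prod[OF assms] pow by (intro prod_mono) auto
qed

lemma extinction_prob_tendsto:
  fixes m :: "nat \<Rightarrow> nat"
  assumes lim: "(\<lambda>n. real (m n) / sqrt (real n)) \<longlonglongrightarrow> x"
  shows "(\<lambda>n. extinction_prob n (m n) (Suc (m n))) \<longlonglongrightarrow> exp (- x\<^sup>2)"
proof -
  \<comment> \<open>In terms of \<open>t = m / sqrt n\<close> and \<open>e = 1 / sqrt n\<close>, which converge to x and 0, the exponents are
    \<open>(t + e) (t + 2 e)\<close> divided by \<open>1 + 2 e\<^sup>2\<close> and by \<open>1 - 2 t e\<close>.\<close>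
  let ?t = "\<lambda>n. real (m n) / sqrt (real n)" and ?e = "\<lambda>n. 1 / sqrt (real n)"
  have e: "?e \<longlonglongrightarrow> 0" by real_asymp
  have small: "(\<lambda>n. ?t n * ?e n) \<longlonglongrightarrow> 0" using tendsto_mult[OF lim e] by simp
  have num: "(\<lambda>n. (?t n + ?e n) * (?t n + 2 * ?e n)) \<longlonglongrightarrow> x\<^sup>2"
    using tendsto_mult[OF tendsto_add[OF lim e] tendsto_add[OF lim tendsto_mult[OF tendsto_const[of 2] e]]]
    by (simp add: power2_eq_square)
  have ev: "\<forall>\<^sub>F n in sequentially. 0 < n \<and> 2 * m n < n"
    using eventually_gt_at_top[of 0] order_tendstoD(2)[OF small, of "1/2"]
    by (auto elim!: eventually_elim2 simp: field_simps)
  have quot: "(real (m n) + 1) * (real (m n) + 2) / (real n * c) =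
      (?t n + ?e n) * (?t n + 2 * ?e n) / c" if "0 < n" for n and c :: real
  proof -
    have "(?t n + ?e n) * (?t n + 2 * ?e n) = (real (m n) + 1) * (real (m n) + 2) / real n"
      using that by (simp add: add_divide_distrib[symmetric])
    then show ?thesis by simp
  qed
  have "(\<lambda>n. (?t n + ?e n) * (?t n + 2 * ?e n) / (1 + 2 * (?e n * ?e n))) \<longlonglongrightarrow> x\<^sup>2"
    using tendsto_divide[OF num tendsto_add[OF tendsto_const[of 1]
        tendsto_mult[OF tendsto_const[of 2] tendsto_mult[OF e e]]]] by simp
  moreover have "\<forall>\<^sub>F n in sequentially.
      (?t n + ?e n) * (?t n + 2 * ?e n) / (1 + 2 * (?e n * ?e n)) =
      (real (m n) + 1) * (real (m n) + 2) / (real n + 2)"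
    using ev
  proof eventually_elim
    case (elim n)
    then have "real n + 2 = real n * (1 + 2 * (?e n * ?e n))" by (simp add: field_simps)
    with quot[of n] elim show ?case by simp
  qed
  ultimately have up: "(\<lambda>n. (real (m n) + 1) * (real (m n) + 2) / (real n + 2)) \<longlonglongrightarrow> x\<^sup>2"
    by (rule Lim_transform_eventually)
  have "(\<lambda>n. (?t n + ?e n) * (?t n + 2 * ?e n) / (1 - 2 * (?t n * ?e n))) \<longlonglongrightarrow> x\<^sup>2"
    using tendsto_divide[OF num tendsto_diff[OF tendsto_const[of 1]
        tendsto_mult[OF tendsto_const[of 2] small]]] by simp
  moreover have "\<forall>\<^sub>F n in sequentially.
      (?t n + ?e n) * (?t n + 2 * ?e n) / (1 - 2 * (?t n * ?e n)) =
      (real (m n) + 1) * (real (m n) + 2) / (real n - 2 * real (m n))"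
    using ev
  proof eventually_elim
    case (elim n)
    then have "real n - 2 * real (m n) = real n * (1 - 2 * (?t n * ?e n))" by (simp add: field_simps)
    with quot[of n] elim show ?case by simp
  qed
  ultimately have low: "(\<lambda>n. (real (m n) + 1) * (real (m n) + 2) / (real n - 2 * real (m n))) \<longlonglongrightarrow> x\<^sup>2"
    by (rule Lim_transform_eventually)
  show ?thesis
  proof (rule tendsto_sandwich)
    show "(\<lambda>n. exp (- ((real (m n) + 1) * (real (m n) + 2) / (real n - 2 * real (m n))))) \<longlonglongrightarrow> exp (- x\<^sup>2)"
      "(\<lambda>n. exp (- ((real (m n) + 1) * (real (m n) + 2) / (real n + 2)))) \<longlonglongrightarrow> exp (- x\<^sup>2)"
      by (intro tendsto_exp tendsto_minus low up)+
    show "\<forall>\<^sub>F n in sequentially.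
        exp (- ((real (m n) + 1) * (real (m n) + 2) / (real n - 2 * real (m n)))) \<le> extinction_prob n (m n) (Suc (m n))"
      "\<forall>\<^sub>F n in sequentially.
        extinction_prob n (m n) (Suc (m n)) \<le> exp (- ((real (m n) + 1) * (real (m n) + 2) / (real n + 2)))"
      using ev by (auto elim!: eventually_mono intro: extinction_prob_bounds)
  qed
qed

section \<open>The limit law\<close>

lemma floor_scaled_sqrt_tendsto:
  assumes "0 \<le> x"
  shows "(\<lambda>n. real (Suc (nat \<lfloor>x * sqrt (real n)\<rfloor>)) / sqrt (real n)) \<longlonglongrightarrow> x"
proof (rule tendsto_sandwich)
  have le: "x * sqrt (real n) \<le> real (Suc (nat \<lfloor>x * sqrt (real n)\<rfloor>)) \<and>
      real (Suc (nat \<lfloor>x * sqrt (real n)\<rfloor>)) \<le> x * sqrt (real n) + 1" for n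
  proof -
    have "0 \<le> x * sqrt (real n)" using assms by simp
    then show ?thesis by linarith
  qed
  have div: "x \<le> k / sqrt (real n) \<and> k / sqrt (real n) \<le> x + 1 / sqrt (real n)"
    if "0 < n" "x * sqrt (real n) \<le> k \<and> k \<le> x * sqrt (real n) + 1" for k n
    using that by (auto simp: field_simps)
  show "\<forall>\<^sub>F n in sequentially. x \<le> real (Suc (nat \<lfloor>x * sqrt (real n)\<rfloor>)) / sqrt (real n)"
    using eventually_gt_at_top[of 0] by eventually_elim (use div le in blast)
  show "\<forall>\<^sub>F n in sequentially. real (Suc (nat \<lfloor>x * sqrt (real n)\<rfloor>)) / sqrt (real n) \<le> x + 1 / sqrt (real n)"
    using eventually_gt_at_top[of 0] by eventually_elim (use div le in blast)
  show "(\<lambda>n. x + 1 / sqrt (real n)) \<longlonglongrightarrow> x" by real_asymp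
qed simp

theorem theorem2p1p3:
  fixes M :: "'w measure" and A :: "nat \<Rightarrow> 'w \<Rightarrow> int set"
  assumes "annihilation_creation_process M A"
  shows "weak_conv_m
           (\<lambda>n. distr M borel (\<lambda>\<omega>. (real n - real (oldest_age (\<lambda>i. A i \<omega>) n)) / sqrt (real n)))
           (interval_measure limit_cdf)"
  unfolding weak_conv_m_def weak_conv_def cdf_limit
proof (intro allI impI)
  fix x :: real
  let ?O = "\<lambda>n \<omega>. oldest_age (\<lambda>i. A i \<omega>) n"
  let ?X = "\<lambda>n \<omega>. (real n - real (?O n \<omega>)) / sqrt (real n)"
  have "real \<in> borel_measurable borel"
    by (rule borel_measurable_continuous_onI) simp
  then have [measurable]: "(\<lambda>\<omega>. real (?O n \<omega>)) \<in> borel_measurable M" for n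
    by (rule measurable_compose[OF borel_measurable_oldest_age[OF assms]])
  have cdf: "cdf (distr M borel (?X n)) x = \<P>(\<omega> in M. ?X n \<omega> \<le> x)" for n
    unfolding cdf_def2 by (subst measure_distr) (auto intro!: arg_cong[where f="measure M"])
  \<comment> \<open>The distribution functions converge at every x, including \<open>x = 0\<close>, where the same
    argument runs with \<open>m = 1\<close> for all n.\<close>
  show "(\<lambda>n. cdf (distr M borel (?X n)) x) \<longlonglongrightarrow> limit_cdf x"
  proof (cases "0 \<le> x")
    case False
    have "0 \<le> ?X n \<omega>" if "\<omega> \<in> space M" for n \<omega>
      using oldest_age_le[of "\<lambda>i. A i \<omega>" n] process_configs[OF assms that] by simp
    then have "{\<omega> \<in> space M. ?X n \<omega> \<le> x} = {}" for n
      using False by (auto simp: not_le intro: less_le_trans)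
    then have "cdf (distr M borel (?X n)) x = 0" for n unfolding cdf by (simp only: measure_empty)
    then show ?thesis using False by (simp add: limit_cdf_def)
  next
    case True
    let ?k = "\<lambda>n. nat \<lfloor>x * sqrt (real n)\<rfloor>"
    \<comment> \<open>From then on the time \<open>\<lfloor>x sqrt n\<rfloor> + 1\<close> is at most n.\<close>
    have "\<forall>\<^sub>F n in sequentially. x < sqrt (real n)"
      by (rule filterlim_at_top_dense[THEN iffD1, rule_format]) real_asymp
    then have "\<forall>\<^sub>F n in sequentially. 1 - extinction_prob n (Suc (?k n)) (Suc (Suc (?k n))) =
        cdf (distr M borel (?X n)) x"
      using eventually_gt_at_top[of 0]
    proof eventually_elim
      case (elim n)
      have "x * sqrt (real n) < sqrt (real n) * sqrt (real n)"
        using elim by (intro mult_strict_right_mono) auto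
      then have "x * sqrt (real n) < real n" by simp
      then have k: "?k n < n" using elim(2) by linarith
      have "?X n \<omega> \<le> x \<longleftrightarrow> real n - real (?O n \<omega>) \<le> x * sqrt (real n)" for \<omega>
        using elim by (simp add: divide_le_eq)
      then show ?case
        unfolding cdf using prob_oldest_age[OF assms _ k] True by simp
    qed
    moreover have "(\<lambda>n. 1 - extinction_prob n (Suc (?k n)) (Suc (Suc (?k n)))) \<longlonglongrightarrow> 1 - exp (- x\<^sup>2)"
      by (intro tendsto_diff tendsto_const extinction_prob_tendsto floor_scaled_sqrt_tendsto[OF True])
    ultimately have "(\<lambda>n. cdf (distr M borel (?X n)) x) \<longlonglongrightarrow> 1 - exp (- x\<^sup>2)"
      by (rule Lim_transform_eventually[rotated])
    then show ?thesis using True by (simp add: limit_cdf_eq_max)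
  qed
qed

end
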